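(* Let $f\colon M\to M$ be a positively expansive (continuous) map of a compact metric space $(M,\rho)$. Then there are a metric $\mathrm{d}$ on $M$ compatible with the topology of $M$, and constants $\xi>0$ and $\lambda>1$, such that for all $x,y\in M$, if $\mathrm{d}(x,y)<\xi$ then $\mathrm{d}(f(x),f(y))=\lambda\,\mathrm{d}(x,y)$.
   Context: A continuous map $f\colon M\to M$ of a compact metric space $(M,\rho)$ is positively expansive if there is $\delta>0$ such that for all $x\neq y$ in $M$ there is $n\ge 0$ with $\rho(f^n(x),f^n(y))>\delta$. *)

theory Defs
  imports "HOL-Analysis.Analysis"
begin

(* Compactness is not part of the definition; it is a hypothesis wherever it is needed. *)
definition positively_expansive :: "'a set \<Rightarrow> ('a \<Rightarrow> 'a \<Rightarrow> real) \<Rightarrow> ('a \<Rightarrow> 'a) \<Rightarrow> bool" where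
  "positively_expansive M \<rho> f \<longleftrightarrow>
     continuous_map (Metric_space.mtopology M \<rho>) (Metric_space.mtopology M \<rho>) f \<and>
     (\<exists>\<delta>>0. \<forall>x\<in>M. \<forall>y\<in>M. x \<noteq> y \<longrightarrow> (\<exists>n::nat. \<rho> ((f ^^ n) x) ((f ^^ n) y) > \<delta>))"

end

theory Submission
  imports Defs
begin

text \<open>
  Fix an expansivity constant \<open>\<delta>\<close> and let \<open>N x y\<close> be the first time at which the orbits of \<open>x\<close> and
  \<open>y\<close> are more than \<open>\<delta>\<close> apart. As long as \<open>N x y > 0\<close>, one application of \<open>f\<close> lowers \<open>N\<close> by
  exactly one, so for \<open>\<kappa> > 1\<close> it multiplies the function \<open>\<phi> x y = 1 / \<kappa> ^ N x y\<close> by exactly \<open>\<kappa>\<close>. This \<open>\<phi>\<close> has everything that is wanted except the triangle inequality, which has to be restored without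
  losing the exact scaling.

  By compactness there is an \<open>m\<close> such that points at distance at least \<open>\<delta> / 3\<close> separate within \<open>m\<close>
  steps (\<open>uniform_separation\<close>). If \<open>w\<close> and \<open>z\<close> separate at time \<open>n\<close>, one of three consecutive links
  from \<open>w\<close> to \<open>z\<close> has length at least \<open>\<delta> / 3\<close> at time \<open>n\<close>, and therefore separates by time \<open>n + m\<close>
  (\<open>separation_time_triple\<close>). Choosing \<open>\<kappa> ^ m = 2\<close> makes this an inequality for \<open>\<phi>\<close> with the factor 2,
  and Frink's lemma (\<open>Frink_metrization\<close>) gives a metric \<open>D\<close> with \<open>D \<le> \<phi> \<le> 2 D\<close>.

  The metric \<open>D\<close> scales only up to a bounded factor. To make the scaling exact, let \<open>\<mu>\<close> be the square root
  of \<open>\<kappa>\<close> and put \<open>d x y = (SUP i. D (f^i x) (f^i y) / \<mu>^i)\<close>. Shifting the index shows that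
  \<open>d x y\<close> is the maximum of \<open>D x y\<close> and \<open>d (f x) (f y) / \<mu>\<close>. Since \<open>D\<close> grows along nearby orbits at the
  rate \<open>\<kappa>\<close>, which is faster than \<open>\<mu>\<close>, the term with index \<open>2 * m\<close> already dominates the one with index 0:
  the gain \<open>(\<kappa> / \<mu>) ^ (2 * m) = 2\<close> pays for the factor 2 between \<open>D\<close> and \<open>\<phi>\<close>. Hence the maximum is
  the second entry, that is, \<open>d (f x) (f y) = \<mu> * d x y\<close> for nearby points. The topology is the
  original one because both \<open>d\<close> and \<open>\<rho>\<close> are small exactly when \<open>N\<close> is large.
\<close>

section \<open>Metrics from chains\<close>

text \<open>
  The starting point is a separate argument, so the list may be empty. The empty chain stays at its
  starting point and has length 0, which spares case distinctions when chains are cut.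
\<close>

fun chain_length :: "('a \<Rightarrow> 'a \<Rightarrow> real) \<Rightarrow> 'a \<Rightarrow> 'a list \<Rightarrow> real" where
  "chain_length \<phi> x [] = 0"
| "chain_length \<phi> x (y # ps) = \<phi> x y + chain_length \<phi> y ps"

lemma chain_length_append:
  "chain_length \<phi> x (ps @ qs) = chain_length \<phi> x ps + chain_length \<phi> (last (x # ps)) qs"
  by (induction ps arbitrary: x) auto

lemma chain_length_nonneg:
  assumes "\<And>x y. 0 \<le> \<phi> x y"
  shows "0 \<le> chain_length \<phi> x ps"
  using assms by (induction ps arbitrary: x) auto

lemma chain_reverse:
  assumes "\<And>x y. \<phi> x y = \<phi> y x" and "x \<in> M" and "set ps \<subseteq> M"
  obtains qs where "set qs \<subseteq> M" "last (last (x # ps) # qs) = x"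
    "chain_length \<phi> (last (x # ps)) qs = chain_length \<phi> x ps"
proof -
  have "\<exists>qs. set qs \<subseteq> M \<and> last (last (x # ps) # qs) = x \<and>
      chain_length \<phi> (last (x # ps)) qs = chain_length \<phi> x ps"
    using assms(2,3)
  proof (induction ps arbitrary: x)
    case Nil
    show ?case by (intro exI[of _ "[]"]) simp
  next
    case (Cons z ps)
    then obtain qs where qs: "set qs \<subseteq> M" "last (last (z # ps) # qs) = z"
      "chain_length \<phi> (last (z # ps)) qs = chain_length \<phi> z ps"
      by (metis list.set_intros(1) set_subset_Cons subset_iff)
    have "last (x # z # ps) = last (z # ps)" by simp
    moreover have "chain_length \<phi> (last (z # ps)) (qs @ [x]) = chain_length \<phi> x (z # ps)"
      unfolding chain_length_append qs(2,3) by (simp add: assms(1)[of z x])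
    ultimately show ?case
      using qs(1) Cons.prems(1) by (intro exI[of _ "qs @ [x]"]) simp
  qed
  then show thesis using that by blast
qed

text \<open>
  Cut at the first link that takes the running length to \<open>t\<close> or beyond. That link is
  charged to neither of the two parts, so with \<open>t\<close> half of the length both parts have at most half of it.
\<close>

lemma chain_split:
  assumes "\<And>x y. 0 \<le> \<phi> x y" and "ps \<noteq> []" and "0 \<le> t" and "t \<le> chain_length \<phi> x ps"
  obtains us y vs where "ps = us @ y # vs" "chain_length \<phi> x us \<le> t"
    "chain_length \<phi> y vs \<le> chain_length \<phi> x ps - t"
proof -
  have "\<exists>us y vs. ps = us @ y # vs \<and> chain_length \<phi> x us \<le> t \<and>
      chain_length \<phi> y vs \<le> chain_length \<phi> x ps - t"
    using assms(2-)
  proof (induction ps arbitrary: x t)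
    case Nil
    then show ?case by simp
  next
    case (Cons y ps)
    show ?case
    proof (cases "t \<le> \<phi> x y \<or> ps = []")
      case True
      then show ?thesis
        using Cons.prems by (intro exI[of _ "[]"] exI[of _ y] exI[of _ ps]) auto
    next
      case False
      then obtain us z vs where "ps = us @ z # vs" "chain_length \<phi> y us \<le> t - \<phi> x y"
        "chain_length \<phi> z vs \<le> chain_length \<phi> y ps - (t - \<phi> x y)"
        using Cons.IH[of "t - \<phi> x y" y] Cons.prems by auto
      then show ?thesis
        by (intro exI[of _ "y # us"] exI[of _ z] exI[of _ vs]) auto
    qed
  qed
  then show thesis using that by blast
qed

text \<open>
  Cut the chain at a link so that each of the two remaining parts has at most half of the length \<open>S\<close>.
  By induction \<open>\<phi>\<close> between the end points of each part is at most \<open>S\<close>, the cut link is at most \<open>S\<close> as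
  well, and the hypothesis on three links joins the pieces at the cost of the factor 2. The bound thus
  does not deteriorate with the number of links.
\<close>

lemma chain_length_lower_bound:
  assumes nonneg: "\<And>x y. 0 \<le> \<phi> x y"
    and refl: "\<And>x. x \<in> M \<Longrightarrow> \<phi> x x = 0"
    and triple: "\<And>w x y z. \<lbrakk>w \<in> M; x \<in> M; y \<in> M; z \<in> M\<rbrakk>
                  \<Longrightarrow> \<phi> w z \<le> 2 * max (\<phi> w x) (max (\<phi> x y) (\<phi> y z))"
    and "x \<in> M" and "set ps \<subseteq> M"
  shows "\<phi> x (last (x # ps)) \<le> 2 * chain_length \<phi> x ps"
  using assms(4,5)
proof (induction ps arbitrary: x rule: length_induct)
  case (1 ps)
  show ?case
  proof (cases "ps = []")
    case True
    then show ?thesis using refl "1.prems" by simp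
  next
    case False
    define S where "S = chain_length \<phi> x ps"
    have "0 \<le> S" unfolding S_def by (rule chain_length_nonneg[OF nonneg])
    then obtain us y vs where split: "ps = us @ y # vs"
      and us: "chain_length \<phi> x us \<le> S / 2" and vs: "chain_length \<phi> y vs \<le> S / 2"
      using chain_split[of \<phi> ps "S / 2" x] nonneg False unfolding S_def by auto
    define a where "a = last (x # us)"
    have M: "a \<in> M" "y \<in> M" "set us \<subseteq> M" "set vs \<subseteq> M" "last (y # vs) \<in> M"
      using "1.prems" split last_in_set[of us] last_in_set[of vs] unfolding a_def by (auto split: if_splits)
    have "S = chain_length \<phi> x us + \<phi> a y + chain_length \<phi> y vs"
      unfolding S_def split chain_length_append a_def by simp
    then have mid: "\<phi> a y \<le> S"
      using chain_length_nonneg[of \<phi> x us, OF nonneg] chain_length_nonneg[of \<phi> y vs, OF nonneg] by linarith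
    have "\<phi> x a \<le> S"
      using "1.IH"[rule_format, of us x] M us split "1.prems" unfolding a_def by simp
    moreover have "\<phi> y (last (y # vs)) \<le> S"
      using "1.IH"[rule_format, of vs y] M vs split by simp
    ultimately have "\<phi> x (last (y # vs)) \<le> 2 * S"
      using triple[of x a y "last (y # vs)"] M mid "1.prems" by linarith
    then show ?thesis unfolding S_def split by simp
  qed
qed

text \<open>
  The value 0 outside \<open>M\<close> makes nonnegativity and symmetry hold for all arguments, as
  \<^locale>\<open>Metric_space\<close> demands.
\<close>

definition chain_metric :: "'a set \<Rightarrow> ('a \<Rightarrow> 'a \<Rightarrow> real) \<Rightarrow> 'a \<Rightarrow> 'a \<Rightarrow> real" where
  "chain_metric M \<phi> x y =
     (if x \<in> M \<and> y \<in> M then INF ps\<in>{ps. set ps \<subseteq> M \<and> last (x # ps) = y}. chain_length \<phi> x ps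
      else 0)"

text \<open>
  Frink's metrization lemma. The infimum over chains always satisfies the triangle inequality and
  lies below \<open>\<phi>\<close>; the danger is that it collapses to 0, and the bound on chains excludes this.
\<close>

lemma Frink_metrization:
  assumes nonneg: "\<And>x y. 0 \<le> \<phi> x y"
    and sym: "\<And>x y. \<phi> x y = \<phi> y x"
    and zero: "\<And>x y. \<lbrakk>x \<in> M; y \<in> M\<rbrakk> \<Longrightarrow> \<phi> x y = 0 \<longleftrightarrow> x = y"
    and triple: "\<And>w x y z. \<lbrakk>w \<in> M; x \<in> M; y \<in> M; z \<in> M\<rbrakk>
                  \<Longrightarrow> \<phi> w z \<le> 2 * max (\<phi> w x) (max (\<phi> x y) (\<phi> y z))"
  obtains D where "Metric_space M D" "\<And>x y. D x y \<le> \<phi> x y"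
    "\<And>x y. \<lbrakk>x \<in> M; y \<in> M\<rbrakk> \<Longrightarrow> \<phi> x y \<le> 2 * D x y"
proof -
  let ?C = "\<lambda>x y. {ps. set ps \<subseteq> M \<and> last (x # ps) = y}"
  define D where "D = chain_metric M \<phi>"
  have D_le: "D x y \<le> chain_length \<phi> x ps" if "x \<in> M" "y \<in> M" "ps \<in> ?C x y" for x y ps
    unfolding D_def chain_metric_def using that
    by (auto intro!: cINF_lower bdd_belowI2[where m = 0] chain_length_nonneg nonneg)
  have le_D: "c \<le> D x y"
    if "x \<in> M" "y \<in> M" and *: "\<And>ps. ps \<in> ?C x y \<Longrightarrow> c \<le> chain_length \<phi> x ps" for x y c
  proof -
    have "[y] \<in> ?C x y" using that by simp
    then show ?thesis unfolding D_def chain_metric_def using that(1,2) *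
      by (auto intro!: cINF_greatest simp del: last.simps)
  qed
  have outside: "D x y = 0" if "\<not> (x \<in> M \<and> y \<in> M)" for x y
    using that unfolding D_def chain_metric_def by auto
  have D_nonneg: "0 \<le> D x y" for x y
    using le_D[of x y 0] outside[of x y] chain_length_nonneg[OF nonneg] by fastforce
  have upper: "D x y \<le> \<phi> x y" for x y
    using D_le[of x y "[y]"] outside[of x y] nonneg[of x y] by fastforce
  have lower: "\<phi> x y \<le> 2 * D x y" if "x \<in> M" "y \<in> M" for x y
  proof -
    have "\<phi> x y / 2 \<le> D x y"
    proof (rule le_D[OF that])
      fix ps assume "ps \<in> ?C x y"
      then show "\<phi> x y / 2 \<le> chain_length \<phi> x ps"
        using chain_length_lower_bound[of \<phi> M x ps] nonneg zero triple that by auto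
    qed
    then show ?thesis by simp
  qed
  have sym_le: "D x y \<le> D y x" if M: "x \<in> M" "y \<in> M" for x y
  proof (rule le_D)
    fix ps assume "ps \<in> ?C y x"
    then have ps: "set ps \<subseteq> M" "last (y # ps) = x" by blast+
    obtain qs where "set qs \<subseteq> M" "last (x # qs) = y" "chain_length \<phi> x qs = chain_length \<phi> y ps"
      by (rule chain_reverse[OF sym M(2) ps(1)]) (simp only: ps(2))
    then show "D x y \<le> chain_length \<phi> y ps" using D_le[OF M, of qs] by simp
  qed (use M in auto)
  have "Metric_space M D"
  proof
    show "0 \<le> D x y" for x y by (rule D_nonneg)
    show "D x y = D y x" for x y
      using sym_le[of x y] sym_le[of y x] outside[of x y] outside[of y x] by fastforce
    show "D x y = 0 \<longleftrightarrow> x = y" if "x \<in> M" "y \<in> M" for x y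
      using that zero[of x y] upper[of x y] lower[of x y] D_nonneg[of x y] nonneg[of x y] by auto
    show "D x z \<le> D x y + D y z" if M: "x \<in> M" "y \<in> M" "z \<in> M" for x y z
    proof -
      have "D x z - D y z \<le> D x y"
      proof (rule le_D[OF M(1,2)])
        fix ps assume ps: "ps \<in> ?C x y"
        have "D x z - chain_length \<phi> x ps \<le> D y z"
        proof (rule le_D[OF M(2,3)])
          fix qs assume qs: "qs \<in> ?C y z"
          have "ps @ qs \<in> ?C x z" using ps qs by (auto simp: last_append split: if_splits)
          then have "D x z \<le> chain_length \<phi> x (ps @ qs)" by (rule D_le[OF M(1,3)])
          then show "D x z - chain_length \<phi> x ps \<le> chain_length \<phi> y qs"
            unfolding chain_length_append using ps by simp
        qed
        then show "D x z - D y z \<le> chain_length \<phi> x ps" by simp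
      qed
      then show ?thesis by simp
    qed
  qed
  then show thesis using that upper lower by blast
qed

section \<open>Uniform separation\<close>

locale expansive_system = Metric_space M \<rho>
  for M :: "'a set" and \<rho> :: "'a \<Rightarrow> 'a \<Rightarrow> real" +
  fixes f :: "'a \<Rightarrow> 'a" and \<delta> :: real
  assumes compact: "compact_space mtopology"
    and continuous: "continuous_map mtopology mtopology f"
    and \<delta>_pos: "0 < \<delta>"
    and expansive: "\<And>x y. \<lbrakk>x \<in> M; y \<in> M; x \<noteq> y\<rbrakk> \<Longrightarrow> \<exists>n. \<delta> < \<rho> ((f ^^ n) x) ((f ^^ n) y)"
begin

lemma continuous_iterate: "continuous_map mtopology mtopology (f ^^ n)"
proof (induction n)
  case (Suc n)
  then show ?case using continuous_map_compose[OF Suc continuous] by (simp add: o_def)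
qed (simp add: id_def)

lemma iterate_in_M: "x \<in> M \<Longrightarrow> (f ^^ n) x \<in> M"
  using continuous_iterate[of n] by (auto simp: continuous_map_def)

lemma continuous_iterate_distance:
  "continuous_map (prod_topology mtopology mtopology) euclideanreal
     (\<lambda>p. \<rho> ((f ^^ n) (fst p)) ((f ^^ n) (snd p)))"
proof -
  have "continuous_map (prod_topology mtopology mtopology) mtopology (\<lambda>p. (f ^^ n) (fst p))"
    "continuous_map (prod_topology mtopology mtopology) mtopology (\<lambda>p. (f ^^ n) (snd p))"
    using continuous_map_compose[OF continuous_map_fst continuous_iterate]
      continuous_map_compose[OF continuous_map_snd continuous_iterate] by (auto simp: o_def)
  then show ?thesis
    using continuous_map_mdist[of "prod_topology mtopology mtopology" "metric (M, \<rho>)"]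
    by (auto simp: mtopology_of_def)
qed

text \<open>
  The pairs at distance at least \<open>\<epsilon>\<close> that do not separate up to time \<open>m\<close> form a decreasing sequence of
  closed subsets of the compact square. A point in their intersection would be a pair of distinct
  points that never separates.
\<close>

lemma uniform_separation:
  assumes "0 < \<epsilon>"
  obtains m where "\<And>x y. \<lbrakk>x \<in> M; y \<in> M; \<epsilon> \<le> \<rho> x y\<rbrakk> \<Longrightarrow> \<exists>n\<le>m. \<delta> < \<rho> ((f ^^ n) x) ((f ^^ n) y)"
proof (rule ccontr)
  let ?X = "prod_topology mtopology mtopology"
  let ?r = "\<lambda>n p. \<rho> ((f ^^ n) (fst p)) ((f ^^ n) (snd p))"
  define C where "C m = {p \<in> topspace ?X. ?r 0 p \<in> {\<epsilon>..}} \<inter> (\<Inter>n\<le>m. {p \<in> topspace ?X. ?r n p \<in> {..\<delta>}})" for m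
  assume "\<not> thesis"
  then have none: "\<exists>x\<in>M. \<exists>y\<in>M. \<epsilon> \<le> \<rho> x y \<and> (\<forall>n\<le>m. \<rho> ((f ^^ n) x) ((f ^^ n) y) \<le> \<delta>)" for m
    using that by (meson not_le)
  have "C m \<noteq> {}" for m
  proof -
    obtain x y where "x \<in> M" "y \<in> M" "\<epsilon> \<le> \<rho> x y" "\<forall>n\<le>m. \<rho> ((f ^^ n) x) ((f ^^ n) y) \<le> \<delta>"
      using none by blast
    then have "(x, y) \<in> C m" unfolding C_def by auto
    then show ?thesis by blast
  qed
  moreover have "closedin ?X (C m)" for m
    unfolding C_def
    by (intro closedin_Int closedin_INT closedin_continuous_map_preimage[OF continuous_iterate_distance]) auto
  moreover have "decseq C"
    unfolding decseq_def C_def by fastforce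
  moreover have "compact_space ?X" using compact by (simp add: compact_space_prod_topology)
  ultimately have "(\<Inter>m. C m) \<noteq> {}" by (intro compact_space_imp_nest) auto
  then obtain p where p: "\<And>m. p \<in> C m" by blast
  then have "fst p \<in> M" "snd p \<in> M" "\<epsilon> \<le> \<rho> (fst p) (snd p)" and small: "\<And>n. ?r n p \<le> \<delta>"
    unfolding C_def by fastforce+
  then have "fst p \<noteq> snd p" using assms by auto
  then show False
    using expansive[OF \<open>fst p \<in> M\<close> \<open>snd p \<in> M\<close>] small by (meson not_le)
qed

text \<open>
  The value is meaningful for distinct points of \<open>M\<close> only: on the diagonal the set of times is empty.
\<close>

definition separation_time :: "'a \<Rightarrow> 'a \<Rightarrow> nat" where
  "separation_time x y = (LEAST n. \<delta> < \<rho> ((f ^^ n) x) ((f ^^ n) y))"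

lemma separation_time_commute: "separation_time x y = separation_time y x"
  unfolding separation_time_def by (simp add: commute)

lemma separated_at_separation_time:
  "\<lbrakk>x \<in> M; y \<in> M; x \<noteq> y\<rbrakk>
    \<Longrightarrow> \<delta> < \<rho> ((f ^^ separation_time x y) x) ((f ^^ separation_time x y) y)"
  unfolding separation_time_def by (rule LeastI_ex[OF expansive])

lemma separation_time_le:
  "\<delta> < \<rho> ((f ^^ n) x) ((f ^^ n) y) \<Longrightarrow> separation_time x y \<le> n"
  unfolding separation_time_def by (rule Least_le)

lemma separation_time_iterate:
  assumes "x \<in> M" "y \<in> M" "x \<noteq> y" "i \<le> separation_time x y"
  shows "(f ^^ i) x \<noteq> (f ^^ i) y" 
    and "separation_time ((f ^^ i) x) ((f ^^ i) y) = separation_time x y - i"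
proof -
  define N where "N = separation_time x y"
  define N' where "N' = separation_time ((f ^^ i) x) ((f ^^ i) y)"
  have shift: "(f ^^ n) ((f ^^ i) z) = (f ^^ (n + i)) z" for n z by (simp add: funpow_add)
  have N: "\<delta> < \<rho> ((f ^^ (N - i)) ((f ^^ i) x)) ((f ^^ (N - i)) ((f ^^ i) y))"
    using separated_at_separation_time[OF assms(1-3)] assms(4) by (simp add: shift N_def)
  then show ne: "(f ^^ i) x \<noteq> (f ^^ i) y"
    using \<delta>_pos iterate_in_M assms by fastforce
  have "N' \<le> N - i" using separation_time_le[OF N] by (simp add: N'_def)
  moreover have "N \<le> N' + i"
    using separated_at_separation_time[OF iterate_in_M[OF assms(1)] iterate_in_M[OF assms(2)] ne]
      separation_time_le[of "N' + i" x y]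
    by (simp add: shift N_def N'_def)
  ultimately show "separation_time ((f ^^ i) x) ((f ^^ i) y) = separation_time x y - i"
    by (simp add: N_def N'_def)
qed

text \<open>
  At the time when \<open>w\<close> and \<open>z\<close> separate, one of the three links has length at least \<open>\<delta> / 3\<close>, and so it
  separates within \<open>m\<close> further steps. This is a triangle inequality, up to the constant \<open>m\<close>, for the
  exponent of \<open>\<phi>\<close>.
\<close>

lemma separation_time_triple:
  assumes m: "\<And>x y. \<lbrakk>x \<in> M; y \<in> M; \<delta> / 3 \<le> \<rho> x y\<rbrakk> \<Longrightarrow> \<exists>n\<le>m. \<delta> < \<rho> ((f ^^ n) x) ((f ^^ n) y)"
    and M: "w \<in> M" "x \<in> M" "y \<in> M" "z \<in> M" and "w \<noteq> z"
  obtains "w \<noteq> x" "separation_time w x \<le> separation_time w z + m"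
  | "x \<noteq> y" "separation_time x y \<le> separation_time w z + m"
  | "y \<noteq> z" "separation_time y z \<le> separation_time w z + m"
proof -
  define N where "N = separation_time w z"
  let ?g = "f ^^ N"
  have gM: "?g w \<in> M" "?g x \<in> M" "?g y \<in> M" "?g z \<in> M" using M iterate_in_M by auto
  have split_pair: "a \<noteq> b \<and> separation_time a b \<le> N + m"
    if ab: "a \<in> M" "b \<in> M" "\<delta> / 3 \<le> \<rho> (?g a) (?g b)" for a b
  proof -
    obtain n where n: "n \<le> m" "\<delta> < \<rho> ((f ^^ n) (?g a)) ((f ^^ n) (?g b))"
      using m iterate_in_M ab by blast
    then have "separation_time a b \<le> n + N"
      by (intro separation_time_le) (simp add: funpow_add)
    moreover have "a \<noteq> b" using ab \<delta>_pos iterate_in_M[of b N] by auto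
    ultimately show ?thesis using n by simp
  qed
  have "\<delta> < \<rho> (?g w) (?g z)"
    using separated_at_separation_time[OF M(1,4) \<open>w \<noteq> z\<close>] by (simp add: N_def)
  also have "\<dots> \<le> \<rho> (?g w) (?g x) + \<rho> (?g x) (?g y) + \<rho> (?g y) (?g z)"
    using triangle[OF gM(1,2,4)] triangle[OF gM(2,3,4)] by linarith
  finally consider "\<delta> / 3 \<le> \<rho> (?g w) (?g x)" | "\<delta> / 3 \<le> \<rho> (?g x) (?g y)" | "\<delta> / 3 \<le> \<rho> (?g y) (?g z)"
    by linarith
  then show thesis using split_pair M that unfolding N_def by cases blast+
qed

text \<open>
  Finitely many iterates are continuous at \<open>x\<close>; this makes the new metric no finer than \<open>\<rho>\<close>.
\<close>

lemma separation_time_near: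
  assumes "x \<in> M"
  obtains s where "0 < s" "\<And>y. \<lbrakk>y \<in> M; \<rho> x y < s; x \<noteq> y\<rbrakk> \<Longrightarrow> n < separation_time x y"
proof -
  define U where "U i = {y \<in> topspace mtopology. (f ^^ i) y \<in> mball ((f ^^ i) x) \<delta>}" for i
  have "openin mtopology (U i)" for i
    unfolding U_def by (rule openin_continuous_map_preimage[OF continuous_iterate openin_mball])
  then have "openin mtopology (\<Inter>i\<in>{..n}. U i)" by (intro openin_INT2) auto
  moreover have "x \<in> (\<Inter>i\<in>{..n}. U i)"
    unfolding U_def using assms \<delta>_pos iterate_in_M by auto
  ultimately obtain s where s: "0 < s" "mball x s \<subseteq> (\<Inter>i\<in>{..n}. U i)"
    unfolding openin_mtopology by blast
  show thesis
  proof (rule that[OF s(1)])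
    fix y assume y: "y \<in> M" "\<rho> x y < s" "x \<noteq> y"
    then have "y \<in> mball x s" using assms by simp
    then have "\<forall>i\<le>n. \<rho> ((f ^^ i) x) ((f ^^ i) y) < \<delta>" using s(2) unfolding U_def by auto
    then show "n < separation_time x y"
      using separated_at_separation_time[OF assms y(1,3)] by (meson not_le order.asym)
  qed
qed

section \<open>The self-similar metric\<close>

text \<open>
  Replacing \<open>D\<close> by the supremum of its values along the orbit, discounted at the rate \<open>\<mu>\<close>, turns
  expansion up to a factor 2 into exact expansion, because \<open>\<mu>\<close> is smaller than the rate \<open>\<kappa>\<close> of \<open>\<phi>\<close>.
\<close>

lemma self_similar_metric:
  "\<exists>d \<xi> lam. Metric_space M d \<and> Metric_space.mtopology M d = mtopology \<and> 0 < \<xi> \<and> (1::real) < lam \<and>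
     (\<forall>x\<in>M. \<forall>y\<in>M. d x y < \<xi> \<longrightarrow> d (f x) (f y) = lam * d x y)"
proof -
  obtain m0 where m0: "\<And>x y. \<lbrakk>x \<in> M; y \<in> M; \<delta> / 3 \<le> \<rho> x y\<rbrakk> \<Longrightarrow> \<exists>n\<le>m0. \<delta> < \<rho> ((f ^^ n) x) ((f ^^ n) y)"
    using uniform_separation[of "\<delta> / 3"] \<delta>_pos by auto
  \<comment> \<open>A positive \<open>m\<close> is needed for the root below, and for the term with index \<open>2 * m\<close> to come from the images.\<close>
  define m where "m = Suc m0"
  have m: "\<exists>n\<le>m. \<delta> < \<rho> ((f ^^ n) x) ((f ^^ n) y)" if "x \<in> M" "y \<in> M" "\<delta> / 3 \<le> \<rho> x y" for x y
    using m0[OF that] unfolding m_def by (meson le_SucI)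
  \<comment> \<open>The discount rate \<open>\<mu>\<close> has \<open>\<kappa> = \<mu> ^ 2\<close>; then \<open>\<kappa> ^ m = 2\<close> suits Frink's lemma and \<open>(\<kappa> / \<mu>) ^ (2 * m) = 2\<close> the final step.\<close>
  define \<mu> where "\<mu> = root (2 * m) 2"
  have "0 < m" by (simp add: m_def)
  then have \<mu>: "1 < \<mu>" "\<mu> ^ (2 * m) = 2" by (auto simp: \<mu>_def)
  define \<kappa> where "\<kappa> = \<mu> ^ 2"
  have \<kappa>: "1 < \<kappa>" "\<kappa> ^ m = 2" using \<mu> by (auto simp: \<kappa>_def power_mult)
  define \<phi> where "\<phi> x y = (if x = y then 0 else 1 / \<kappa> ^ separation_time x y)" for x y
  have \<phi>_nonneg: "0 \<le> \<phi> x y" and \<phi>_le_1: "\<phi> x y \<le> 1" for x y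
    using \<kappa>(1) by (auto simp: \<phi>_def)
  have \<phi>_antimono: "1 / \<kappa> ^ n \<le> \<phi> x y" if "x \<noteq> y" "separation_time x y \<le> n" for x y n
    using that \<kappa>(1) by (auto simp: \<phi>_def intro!: divide_left_mono power_increasing)
  have triple: "\<phi> w z \<le> 2 * max (\<phi> w x) (max (\<phi> x y) (\<phi> y z))"
    if M: "w \<in> M" "x \<in> M" "y \<in> M" "z \<in> M" for w x y z
  proof (cases "w = z")
    case True
    then show ?thesis using \<phi>_nonneg[of w x] by (simp add: \<phi>_def)
  next
    case False
    let ?N = "separation_time w z"
    have "\<phi> w z = 2 * (1 / \<kappa> ^ (?N + m))"
      using False \<kappa> by (simp add: \<phi>_def power_add)
    moreover have "1 / \<kappa> ^ (?N + m) \<le> max (\<phi> w x) (max (\<phi> x y) (\<phi> y z))"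
      using separation_time_triple[OF m M False] \<phi>_antimono by (smt (verit))
    ultimately show ?thesis by simp
  qed
  obtain D where "Metric_space M D" and D_le: "\<And>x y. D x y \<le> \<phi> x y"
    and \<phi>_le: "\<And>x y. \<lbrakk>x \<in> M; y \<in> M\<rbrakk> \<Longrightarrow> \<phi> x y \<le> 2 * D x y"
  proof (rule Frink_metrization[of \<phi> M])
    show "\<phi> x y = \<phi> y x" for x y by (simp add: \<phi>_def separation_time_commute)
    show "\<phi> x y = 0 \<longleftrightarrow> x = y" for x y using \<kappa>(1) by (simp add: \<phi>_def)
  qed (use \<phi>_nonneg triple in auto)
  interpret D: Metric_space M D by fact
  define T where "T x y i = D ((f ^^ i) x) ((f ^^ i) y) / \<mu> ^ i" for x y i
  define d where "d x y = (SUP i. T x y i)" for x y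
  have D_le_1: "D x y \<le> 1" for x y using D_le \<phi>_le_1 by (rule order_trans)
  have T_le_1: "T x y i \<le> 1" and T_nonneg: "0 \<le> T x y i" for x y i
  proof -
    have "D ((f ^^ i) x) ((f ^^ i) y) \<le> 1" by (rule D_le_1)
    also have "1 \<le> \<mu> ^ i" using \<mu>(1) by simp
    finally show "T x y i \<le> 1" using \<mu>(1) by (simp add: T_def)
    show "0 \<le> T x y i" using \<mu>(1) by (simp add: T_def)
  qed
  have T_le_d: "T x y i \<le> d x y" for x y i
    unfolding d_def using T_le_1 by (intro cSUP_upper bdd_aboveI2) auto
  have d_le: "d x y \<le> c" if "\<And>i. T x y i \<le> c" for x y c
    unfolding d_def using that by (intro cSUP_least) auto
  have D_le_d: "D x y \<le> d x y" for x y
    using T_le_d[of x y 0] by (simp add: T_def)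
  have T_step: "T (f x) (f y) i = \<mu> * T x y (Suc i)" for x y i
    using \<mu>(1) by (simp add: T_def funpow_swap1)
  have "Metric_space M d"
  proof
    show "0 \<le> d x y" for x y using T_nonneg T_le_d by (rule order_trans)
    show "d x y = d y x" for x y unfolding d_def T_def by (simp add: D.commute)
    show "d x y = 0 \<longleftrightarrow> x = y" if "x \<in> M" "y \<in> M" for x y
    proof
      assume "d x y = 0"
      then have "D x y = 0" using D_le_d[of x y] D.nonneg[of x y] by linarith
      then show "x = y" using that by simp
    qed (use that iterate_in_M in \<open>simp add: d_def T_def\<close>)
    show "d x z \<le> d x y + d y z" if "x \<in> M" "y \<in> M" "z \<in> M" for x y z
    proof (rule d_le)
      fix i
      have "T x z i \<le> T x y i + T y z i"
        unfolding T_def add_divide_distrib[symmetric] using \<mu>(1) that iterate_in_M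
        by (intro divide_right_mono D.triangle) auto
      then show "T x z i \<le> d x y + d y z"
        using T_le_d[of x y i] T_le_d[of y z i] by linarith
    qed
  qed
  then interpret d: Metric_space M d .
  have large_time: "n < separation_time x y"
    if "x \<in> M" "y \<in> M" "x \<noteq> y" "d x y < 1 / \<kappa> ^ n / 2" for x y n
  proof (rule ccontr)
    assume "\<not> n < separation_time x y"
    then have "1 / \<kappa> ^ n \<le> \<phi> x y" using \<phi>_antimono that by simp
    also have "\<dots> \<le> 2 * d x y" using \<phi>_le[OF that(1,2)] D_le_d[of x y] by linarith
    finally show False using that(4) by simp
  qed
  have \<phi>_iterate: "\<phi> ((f ^^ i) x) ((f ^^ i) y) = \<kappa> ^ i * \<phi> x y"
    if "x \<in> M" "y \<in> M" "x \<noteq> y" "i \<le> separation_time x y" for x y i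
    using separation_time_iterate[OF that] that \<kappa>(1) by (simp add: \<phi>_def power_diff)
  \<comment> \<open>Terms up to \<open>n\<close> are small since \<open>\<phi>\<close> starts below \<open>1 / \<kappa> ^ n\<close>, later ones since they are discounted.\<close>
  have small_d: "d x y \<le> 1 / \<mu> ^ n"
    if M: "x \<in> M" "y \<in> M" "x \<noteq> y" and n: "n \<le> separation_time x y" for x y n
  proof (rule d_le)
    fix i
    show "T x y i \<le> 1 / \<mu> ^ n"
    proof (cases "i \<le> n")
      case True
      have "\<phi> x y \<le> 1 / \<kappa> ^ n"
        using M n \<kappa>(1) by (auto simp: \<phi>_def intro!: divide_left_mono power_increasing)
      then have "D ((f ^^ i) x) ((f ^^ i) y) \<le> \<kappa> ^ i * (1 / \<kappa> ^ n)"
        using D_le[of "(f ^^ i) x" "(f ^^ i) y"] \<phi>_iterate[of x y i] M n True \<kappa>(1)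
        by (smt (verit) mult_left_mono zero_le_power order_trans)
      then have "T x y i \<le> \<kappa> ^ i * (1 / \<kappa> ^ n) / \<mu> ^ i"
        unfolding T_def using \<mu>(1) by (intro divide_right_mono) auto
      also have "\<dots> = \<mu> ^ i / \<mu> ^ n * (1 / \<mu> ^ n)"
        using \<mu>(1) by (simp add: \<kappa>_def power2_eq_square power_mult_distrib)
      also have "\<dots> \<le> 1 * (1 / \<mu> ^ n)"
        using \<mu>(1) True by (intro mult_right_mono) (auto simp: power_increasing)
      finally show ?thesis by simp
    next
      case False
      have "T x y i \<le> 1 / \<mu> ^ i"
        unfolding T_def using \<mu>(1) by (intro divide_right_mono D_le_1) simp
      also have "\<dots> \<le> 1 / \<mu> ^ n"
        using \<mu>(1) False by (auto intro!: divide_left_mono power_increasing)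
      finally show ?thesis .
    qed
  qed
  have "d.mtopology = mtopology"
    unfolding topology_eq openin_mtopology d.openin_mtopology
  proof -
    \<comment> \<open>If \<open>d\<close> is small, the points separate late, and uniform separation forces \<open>\<rho>\<close> to be small.\<close>
    have fine: "\<exists>s>0. d.mball x s \<subseteq> mball x r" if "0 < r" for x r
    proof -
      obtain n where n: "\<And>x y. \<lbrakk>x \<in> M; y \<in> M; r \<le> \<rho> x y\<rbrakk> \<Longrightarrow> \<exists>k\<le>n. \<delta> < \<rho> ((f ^^ k) x) ((f ^^ k) y)"
        using uniform_separation[OF \<open>0 < r\<close>] by auto
      have "\<rho> x y < r" if "x \<in> M" "y \<in> M" "d x y < 1 / \<kappa> ^ n / 2" for y
      proof (rule ccontr)
        assume "\<not> \<rho> x y < r"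
        then have "x \<noteq> y" "separation_time x y \<le> n"
          using n[OF that(1,2)] \<open>0 < r\<close> that separation_time_le by (auto intro: order_trans)
        then show False using large_time[OF that(1,2) _ that(3)] by simp
      qed
      then show ?thesis using \<kappa>(1) by (intro exI[of _ "1 / \<kappa> ^ n / 2"]) auto
    qed
    have coarse: "\<exists>s>0. mball x s \<subseteq> d.mball x r" if "0 < r" for x r
    proof (cases "x \<in> M")
      case True
      obtain n where "1 / r < \<mu> ^ n" using real_arch_pow[OF \<mu>(1)] by blast
      then have n: "1 / \<mu> ^ n < r" using \<open>0 < r\<close> \<mu>(1) by (simp add: field_simps)
      obtain s where s: "0 < s" "\<And>y. \<lbrakk>y \<in> M; \<rho> x y < s; x \<noteq> y\<rbrakk> \<Longrightarrow> n < separation_time x y"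
        using separation_time_near[OF True] by metis
      have "d x y < r" if "y \<in> M" "\<rho> x y < s" for y
        using small_d[of x y n] s(2)[OF that] n True that \<open>0 < r\<close> by (cases "x = y") auto
      then show ?thesis using s(1) by (intro exI[of _ s]) auto
    qed (auto intro: exI[of _ 1])
    show "\<forall>U. (U \<subseteq> M \<and> (\<forall>x. x \<in> U \<longrightarrow> (\<exists>r>0. d.mball x r \<subseteq> U))) =
      (U \<subseteq> M \<and> (\<forall>x. x \<in> U \<longrightarrow> (\<exists>r>0. mball x r \<subseteq> U)))"
      using fine coarse by (meson order_trans)
  qed
  moreover have "d (f x) (f y) = \<mu> * d x y"
    if M: "x \<in> M" "y \<in> M" and close: "d x y < 1 / \<kappa> ^ (2 * m) / 2" for x y
  proof (cases "x = y")
    case True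
    then show ?thesis using M iterate_in_M[of y 1] by simp
  next
    case False
    have "2 * m \<le> separation_time x y" using large_time[OF M False close] by simp
    then have "\<kappa> ^ (2 * m) * \<phi> x y \<le> 2 * D ((f ^^ (2 * m)) x) ((f ^^ (2 * m)) y)"
      using \<phi>_iterate[OF M False] \<phi>_le iterate_in_M M by metis
    moreover have "\<kappa> ^ (2 * m) = 4" using \<kappa>(2) by (simp add: mult.commute[of 2] power_mult)
    ultimately have "\<phi> x y \<le> T x y (2 * m)" by (simp add: T_def \<mu>(2))
    \<comment> \<open>The supremum for \<open>x\<close> and \<open>y\<close> is thus taken over positive indices, which are the terms for the images.\<close>
    then have T0: "T x y 0 \<le> T x y (2 * m)"
      using D_le[of x y] by (simp add: T_def)
    have "T x y i \<le> d (f x) (f y) / \<mu>" for i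
    proof -
      have Suc: "T x y (Suc j) \<le> d (f x) (f y) / \<mu>" for j
        using T_le_d[of "f x" "f y" j] \<mu>(1) by (simp add: T_step field_simps)
      show ?thesis
      proof (cases i)
        case 0
        then show ?thesis using T0 Suc[of "2 * m - 1"] \<open>0 < m\<close> by simp
      qed (simp add: Suc)
    qed
    then have "d x y \<le> d (f x) (f y) / \<mu>" by (rule d_le)
    moreover have "d (f x) (f y) \<le> \<mu> * d x y"
      using T_le_d[of x y] \<mu>(1) by (intro d_le) (simp add: T_step)
    ultimately show ?thesis using \<mu>(1) by (simp add: field_simps)
  qed
  ultimately show ?thesis
    using \<open>Metric_space M d\<close> \<mu>(1) \<kappa>(1)
    by (intro exI[of _ d] exI[of _ "1 / \<kappa> ^ (2 * m) / 2"] exI[of _ \<mu>]) auto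
qed

end

theorem theorem2p8:
  fixes M :: "'a set" and \<rho> :: "'a \<Rightarrow> 'a \<Rightarrow> real" and f :: "'a \<Rightarrow> 'a"
  assumes "Metric_space M \<rho>"
    and "compact_space (Metric_space.mtopology M \<rho>)"
    and "positively_expansive M \<rho> f"
  shows "\<exists>(d :: 'a \<Rightarrow> 'a \<Rightarrow> real) (\<xi> :: real) (lam :: real).
           Metric_space M d \<and>
           Metric_space.mtopology M d = Metric_space.mtopology M \<rho> \<and>
           \<xi> > 0 \<and> lam > 1 \<and>
           (\<forall>x\<in>M. \<forall>y\<in>M. d x y < \<xi> \<longrightarrow> d (f x) (f y) = lam * d x y)"
proof -
  interpret Metric_space M \<rho> by fact
  obtain \<delta> where "0 < \<delta>"
    "\<And>x y. \<lbrakk>x \<in> M; y \<in> M; x \<noteq> y\<rbrakk> \<Longrightarrow> \<exists>n. \<delta> < \<rho> ((f ^^ n) x) ((f ^^ n) y)"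
    and "continuous_map mtopology mtopology f"
    using assms(3) unfolding positively_expansive_def by blast
  then interpret expansive_system M \<rho> f \<delta>
    using assms(2) by unfold_locales auto
  show ?thesis by (rule self_similar_metric)
qed

end
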